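(* Let $A\in\mathbb{R}^{n\times n}$, $B\in\mathbb{R}^{n\times n_u}$, $C\in\mathbb{R}^{n_y\times n}$ with $(A,C)$ observable. Let $L_c,N_c\in\mathbb{R}^{n\times n_y}$ and $\theta=\theta^T\in\mathbb{R}^{n_y\times n_y}$, $\theta\ge 0$ (so $C^T\theta C\ge 0$), and let $P=P^T\in\mathbb{R}^{n\times n}$ be positive definite. Suppose that (i) there is no $v\in\mathbb{R}^n$, $v\neq 0$, with $(A-L_cC)v+(v^TC^T\theta Cv)\,N_cCv=0$; (ii) $(A-L_cC)^TP+P(A-L_cC)<0$; (iii) $PN_cC+C^TN_c^TP<0$. Then the estimation error dynamics $$\dot e_c(t)=(A-L_cC)e_c(t)+\big(e_c^T(t)C^T\theta Ce_c(t)\big)N_cCe_c(t)$$ of the cubic observer for the system $\dot x=Ax+Bu,\ y=Cx$ are globally stable.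
   Context: The plant is $\dot x(t)=Ax(t)+Bu(t)$, $y(t)=Cx(t)$, with $u$ a known input. The cubic observer is $$\dot{\hat x}_c=(A-L_cC)\hat x_c+L_cy+Bu-(e_c^TC^T\theta Ce_c)N_cCe_c,\qquad e_c=x-\hat x_c,$$ whose estimation error $e_c$ satisfies the differential equation displayed in the claim. For symmetric matrices, $M<0$ means negative definite and $M\ge 0$ positive semidefinite. "Globally stable" is used without further specification; the argument uses the Lyapunov function $V_c=e_c^TPe_c$ and asserts that its derivative along the error dynamics is negative. *)

theory Defs
  imports "HOL-Analysis.Analysis"
begin

definition pos_definite :: "real ^ 'n ^ 'n \<Rightarrow> bool" where
  "pos_definite M \<longleftrightarrow> transpose M = M \<and> (\<forall>v. v \<noteq> 0 \<longrightarrow> v \<bullet> (M *v v) > 0)"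

definition pos_semidefinite :: "real ^ 'n ^ 'n \<Rightarrow> bool" where
  "pos_semidefinite M \<longleftrightarrow> transpose M = M \<and> (\<forall>v. v \<bullet> (M *v v) \<ge> 0)"

definition neg_definite :: "real ^ 'n ^ 'n \<Rightarrow> bool" where
  "neg_definite M \<longleftrightarrow> transpose M = M \<and> (\<forall>v. v \<noteq> 0 \<longrightarrow> v \<bullet> (M *v v) < 0)"

(* At the end points of the interval I the derivative is one-sided. *)
definition ode_solution ::
    "(real \<Rightarrow> 'a::real_normed_vector \<Rightarrow> 'a) \<Rightarrow> real set \<Rightarrow> (real \<Rightarrow> 'a) \<Rightarrow> bool" where
  "ode_solution f I x \<longleftrightarrow> (\<forall>t\<in>I. (x has_vector_derivative f t (x t)) (at t within I))"

(* Observability of the pair (A, C): on every time interval [0, T] the output y = C x of the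
   unforced system determines the initial state. *)
definition observable :: "real ^ 'n ^ 'n \<Rightarrow> real ^ 'n ^ 'y \<Rightarrow> bool" where
  "observable A C \<longleftrightarrow>
    (\<forall>T>0. \<forall>x z.
       ode_solution (\<lambda>t v. A *v v) {0..T} x \<longrightarrow>
       ode_solution (\<lambda>t v. A *v v) {0..T} z \<longrightarrow>
       (\<forall>t\<in>{0..T}. C *v x t = C *v z t) \<longrightarrow> x 0 = z 0)"

definition plant_rhs ::
    "real ^ 'n ^ 'n \<Rightarrow> real ^ 'u ^ 'n \<Rightarrow> (real \<Rightarrow> real ^ 'u) \<Rightarrow> real \<Rightarrow> real ^ 'n \<Rightarrow> real ^ 'n" where
  "plant_rhs A B u t x = A *v x + B *v u t"

(* The plant state x is an argument because the observer is driven by y = C x and the cubic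
   output injection is a function of e = x - xh (through C e = y - C xh). *)
definition cubic_observer_rhs ::
    "real ^ 'n ^ 'n \<Rightarrow> real ^ 'u ^ 'n \<Rightarrow> real ^ 'n ^ 'y \<Rightarrow> real ^ 'y ^ 'n \<Rightarrow> real ^ 'y ^ 'n \<Rightarrow>
     real ^ 'y ^ 'y \<Rightarrow> (real \<Rightarrow> real ^ 'u) \<Rightarrow> (real \<Rightarrow> real ^ 'n) \<Rightarrow> real \<Rightarrow> real ^ 'n \<Rightarrow> real ^ 'n" where
  "cubic_observer_rhs A B C L N \<theta> u x t xh =
     (let y = C *v x t; e = x t - xh in
      (A - L ** C) *v xh + L *v y + B *v u t
      - (e \<bullet> ((transpose C ** \<theta> ** C) *v e)) *\<^sub>R ((N ** C) *v e))"

definition cubic_error_rhs ::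
    "real ^ 'n ^ 'n \<Rightarrow> real ^ 'n ^ 'y \<Rightarrow> real ^ 'y ^ 'n \<Rightarrow> real ^ 'y ^ 'n \<Rightarrow> real ^ 'y ^ 'y \<Rightarrow>
     real ^ 'n \<Rightarrow> real ^ 'n" where
  "cubic_error_rhs A C L N \<theta> e =
     (A - L ** C) *v e + (e \<bullet> ((transpose C ** \<theta> ** C) *v e)) *\<^sub>R ((N ** C) *v e)"

(* Global asymptotic stability of the origin for e' = f e: solutions exist on [0, \<infinity>) from every
   initial value (not automatic for nonlinear f), the origin is Lyapunov stable, and every solution
   on [0, \<infinity>) tends to it.  The first two conjuncts force f 0 = 0. *)
definition globally_stable :: "('a::real_normed_vector \<Rightarrow> 'a) \<Rightarrow> bool" where
  "globally_stable f \<longleftrightarrow>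
     (\<forall>e0. \<exists>e. ode_solution (\<lambda>t. f) {0..} e \<and> e 0 = e0) \<and>
     (\<forall>\<epsilon>>0. \<exists>\<delta>>0. \<forall>e. ode_solution (\<lambda>t. f) {0..} e \<and> norm (e 0) < \<delta> \<longrightarrow>
        (\<forall>t\<ge>0. norm (e t) < \<epsilon>)) \<and>
     (\<forall>e. ode_solution (\<lambda>t. f) {0..} e \<longrightarrow> (e \<longlongrightarrow> 0) at_top)"

end

theory Submission
  imports Defs
begin

text \<open>
  The function \<open>V e = e \<bullet> (P *v e)\<close> is a strict Lyapunov function for the error dynamics.  Along a
  solution its derivative is the quadratic form of \<open>(A - L C)\<^sup>T P + P (A - L C)\<close> plus the scalar
  \<open>(C e) \<bullet> (\<theta> *v (C e)) \<ge> 0\<close> times the quadratic form of \<open>P N C + C\<^sup>T N\<^sup>T P\<close>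
  (\<open>lyapunov_derivative_decomposition\<close>).  The cubic term therefore never increases \<open>V\<close>, and by
  compactness of the unit sphere the linear term gives \<open>V' \<le> - k (norm e)\<^sup>2\<close> with some \<open>k > 0\<close>.  As
  \<open>V\<close> lies between two positive multiples of \<open>(norm e)\<^sup>2\<close>, this is \<open>V' \<le> - r V\<close>, so every solution obeys
  an exponential envelope \<open>norm (e t) \<le> G * norm (e 0) * exp (- r t / 2)\<close>, from which stability and attraction
  are read off (\<open>quadratic_lyapunov_globally_stable\<close>).

  It remains to see that solutions exist for all forward time, although the right-hand side is
  cubic.  Outside a ball of radius \<open>R\<close> the field \<open>f\<close> is replaced by its value at the radial
  projection \<open>\<pi>\<close> onto the ball.  The new field is globally Lipschitz, so it has global solutions
  by a contraction argument (\<open>lipschitz_ode_solution_exists\<close>).  Since \<open>v\<close> is a nonnegative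
  multiple of \<open>\<pi> v\<close>, the derivative of \<open>V\<close> along the new field still has the right sign
  everywhere.  Hence \<open>V\<close> does not increase, and for \<open>R\<close> large enough in terms of the initial value
  the solution never leaves the ball, where the two fields agree
  (\<open>lyapunov_ode_solution_exists\<close>).
\<close>

section \<open>Solutions of globally Lipschitz equations\<close>

lemma has_vector_derivative_integral_atLeast:
  fixes h :: "real \<Rightarrow> 'a::banach"
  assumes h: "continuous_on {0..} h" and t: "t \<ge> 0"
  shows "((\<lambda>u. integral {0..u} h) has_vector_derivative h t) (at t within {0..})"
proof -
  have "((\<lambda>u. integral {0..u} h) has_vector_derivative h t) (at t within {0..t + 1})"
    using t by (intro integral_has_vector_derivative continuous_on_subset[OF h]) auto
  moreover have "at t within {0..t + 1} = at t within {0..}"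
    by (rule at_within_nhd[where S = "{..<t + 1}"]) auto
  ultimately show ?thesis by simp
qed

text \<open>
  This single estimate shows both that the Picard operator maps bounded functions to bounded
  functions and that it is a contraction: integrating \<open>exp (K s)\<close> gains the factor \<open>1 / K\<close>, which
  is as small as desired, uniformly in time.
\<close>
lemma exp_weighted_integral_bound:
  fixes h :: "real \<Rightarrow> 'a::banach"
  assumes h: "continuous_on {0..} h" and t: "t \<ge> 0" and K: "K > 0" and c: "c \<ge> 0"
    and bound: "\<And>s. s \<ge> 0 \<Longrightarrow> norm (h s) \<le> c * exp (K * s)"
  shows "exp (- K * t) * norm (integral {0..t} h) \<le> c / K"
proof -
  have int: "((\<lambda>s. c * exp (K * s)) has_integral c * exp (K * t) / K - c * exp (K * 0) / K) {0..t}"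
  proof (rule fundamental_theorem_of_calculus)
    fix s
    show "((\<lambda>s. c * exp (K * s) / K) has_vector_derivative c * exp (K * s)) (at s within {0..t})"
      using K unfolding has_real_derivative_iff_has_vector_derivative[symmetric]
      by (auto intro!: derivative_eq_intros)
  qed (use t in auto)
  have "norm (integral {0..t} h) \<le> integral {0..t} (\<lambda>s. c * exp (K * s))"
    using bound by (intro integral_norm_bound_integral integrable_continuous_real
        continuous_intros continuous_on_subset[OF h]) auto
  also have "\<dots> \<le> c * exp (K * t) / K"
    using integral_unique[OF int] c K by simp
  finally have "exp (- K * t) * norm (integral {0..t} h) \<le> exp (- K * t) * (c * exp (K * t) / K)"
    by (intro mult_left_mono) auto
  also have "\<dots> = c / K" by (simp add: exp_minus field_simps)
  finally show ?thesis .
qed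

text \<open>
  Solutions on a short interval would have to be continued step by step.  Writing a candidate
  solution as \<open>e0 + exp (K t) u t\<close> with \<open>u\<close> bounded (Bielecki's weighted norm) makes the Picard
  operator a contraction on the whole half-line at once.
\<close>
theorem lipschitz_ode_solution_exists:
  fixes g :: "'a::banach \<Rightarrow> 'a"
  assumes lip: "L-lipschitz_on UNIV g"
  shows "\<exists>e. ode_solution (\<lambda>t. g) {0..} e \<and> e 0 = e0"
proof -
  \<comment> \<open>The contraction factor is \<open>L / K \<le> 1 / 2\<close>; adding \<open>1\<close> keeps \<open>K\<close> positive when \<open>L = 0\<close>.\<close>
  define K where "K = 2 * (L + 1)"
  have L: "L \<ge> 0" using lip by (rule lipschitz_on_nonneg)
  then have K: "K > 0" by (simp add: K_def)
  have cont_g: "continuous_on UNIV g" using lip by (rule lipschitz_on_continuous_on)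
  define y :: "(real \<Rightarrow>\<^sub>C 'a) \<Rightarrow> real \<Rightarrow> 'a"
    where "y u s = e0 + exp (K * s) *\<^sub>R u s" for u s
  \<comment> \<open>The unknown \<open>u\<close> lives on all of \<open>real\<close>; clamping with \<open>max 0\<close> extends the
      operator constantly to negative times.\<close>
  define F :: "(real \<Rightarrow>\<^sub>C 'a) \<Rightarrow> real \<Rightarrow> 'a"
    where "F u t = exp (- K * max 0 t) *\<^sub>R integral {0..max 0 t} (\<lambda>s. g (y u s))" for u t
  have cont_gy: "continuous_on S (\<lambda>s. g (y u s))" for S u
    unfolding y_def by (intro continuous_on_compose2[OF cont_g] continuous_intros) auto
  have deriv_int: "((\<lambda>u. integral {0..u} (\<lambda>s. g (y v s))) has_vector_derivative g (y v t))
      (at t within {0..})" if "t \<ge> 0" for v t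
    using that by (intro has_vector_derivative_integral_atLeast cont_gy)
  have cont_int: "continuous_on {0..} (\<lambda>t. integral {0..t} (\<lambda>s. g (y u s)))" for u
    using deriv_int has_vector_derivative_continuous
    by (auto simp: continuous_on_eq_continuous_within) blast
  have F_bcont: "F u \<in> bcontfun" for u
  proof (rule bcontfun_normI)
    show "continuous_on UNIV (F u)"
      unfolding F_def by (intro continuous_intros continuous_on_compose2[OF cont_int]) auto
    fix t
    have "norm (F u t) = exp (- K * max 0 t) * norm (integral {0..max 0 t} (\<lambda>s. g (y u s)))"
      by (simp add: F_def)
    also have "\<dots> \<le> (norm (g e0) + L * norm u) / K"
    proof (rule exp_weighted_integral_bound[OF cont_gy _ K])
      fix s :: real assume s: "s \<ge> 0"
      have "norm (g (y u s)) \<le> norm (g e0) + dist (g (y u s)) (g e0)"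
        by (metis add.commute dist_norm norm_triangle_sub)
      also have "dist (g (y u s)) (g e0) \<le> L * dist (y u s) e0"
        using lipschitz_onD[OF lip] by simp
      also have "L * dist (y u s) e0 \<le> L * (exp (K * s) * norm u)"
        using L by (intro mult_left_mono) (simp_all add: y_def dist_norm norm_bounded)
      also have "norm (g e0) \<le> norm (g e0) * exp (K * s)"
        using K s by (simp add: mult_le_cancel_left1)
      finally show "norm (g (y u s)) \<le> (norm (g e0) + L * norm u) * exp (K * s)"
        by (simp add: algebra_simps)
    qed (use L in auto)
    finally show "norm (F u t) \<le> (norm (g e0) + L * norm u) / K" .
  qed
  define \<Phi> where "\<Phi> u = Bcontfun (F u)" for u
  have \<Phi>: "apply_bcontfun (\<Phi> u) = F u" for u
    unfolding \<Phi>_def using F_bcont by (rule Bcontfun_inverse)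
  have "\<exists>!u. \<Phi> u = u"
  proof (rule banach_fix_type[where c = "1 / 2"])
    have "dist (\<Phi> u) (\<Phi> w) \<le> 1 / 2 * dist u w" for u w
    proof (rule dist_bound)
      fix t
      let ?h = "\<lambda>s. g (y u s) - g (y w s)"
      have "dist (\<Phi> u t) (\<Phi> w t) = exp (- K * max 0 t) * norm (integral {0..max 0 t} ?h)"
        by (simp add: \<Phi> F_def dist_norm Henstock_Kurzweil_Integration.integral_diff
            integrable_continuous_real cont_gy flip: scaleR_diff_right)
      also have "\<dots> \<le> (L * dist u w) / K"
      proof (rule exp_weighted_integral_bound[OF _ _ K])
        fix s :: real
        have "norm (?h s) \<le> L * dist (y u s) (y w s)"
          using lipschitz_onD[OF lip] by (simp add: dist_norm)
        also have "dist (y u s) (y w s) = exp (K * s) * dist (u s) (w s)"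
          by (simp add: y_def dist_norm flip: scaleR_diff_right)
        also have "L * \<dots> \<le> L * (exp (K * s) * dist u w)"
          using L by (intro mult_left_mono dist_bounded) auto
        finally show "norm (?h s) \<le> L * dist u w * exp (K * s)" by (simp add: mult_ac)
      qed (use L in \<open>auto intro!: continuous_intros cont_gy\<close>)
      also have "\<dots> \<le> 1 / 2 * dist u w"
        using L by (simp add: K_def field_simps)
      finally show "dist (\<Phi> u t) (\<Phi> w t) \<le> 1 / 2 * dist u w" .
    qed
    then show "\<forall>u w. dist (\<Phi> u) (\<Phi> w) \<le> 1 / 2 * dist u w" by blast
  qed auto
  then obtain u where u: "\<Phi> u = u" by blast
  have y_eq: "y u t = e0 + integral {0..t} (\<lambda>s. g (y u s))" if "t \<ge> 0" for t
  proof -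
    have "u t = exp (- K * t) *\<^sub>R integral {0..t} (\<lambda>s. g (y u s))"
      using that \<Phi>[of u] unfolding u by (simp add: F_def)
    then show ?thesis by (simp add: y_def exp_minus)
  qed
  have "(y u has_vector_derivative g (y u t)) (at t within {0..})" if "t \<ge> 0" for t
  proof (rule has_vector_derivative_transform)
    show "((\<lambda>t. e0 + integral {0..t} (\<lambda>s. g (y u s))) has_vector_derivative g (y u t))
        (at t within {0..})"
      using deriv_int[OF that, of u] by (auto intro!: derivative_eq_intros)
  qed (use that y_eq in auto)
  then show ?thesis
    using y_eq[of 0] by (intro exI[of _ "y u"]) (auto simp: ode_solution_def)
qed

section \<open>Radial truncation\<close>

lemma closest_point_cball_0:
  fixes v :: "'a::euclidean_space"
  assumes R: "R > 0" and v: "norm v \<ge> R"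
  shows "closest_point (cball 0 R) v = (R / norm v) *\<^sub>R v"
proof (rule closest_point_unique[symmetric])
  have v_pos: "norm v > 0" using R v by linarith
  show "\<forall>z\<in>cball 0 R. dist v ((R / norm v) *\<^sub>R v) \<le> dist v z"
  proof
    fix z assume "z \<in> cball (0::'a) R"
    then have "norm v - R \<le> dist v z"
      using norm_triangle_ineq2[of v z] by (simp add: dist_norm)
    moreover have "v - (R / norm v) *\<^sub>R v = ((norm v - R) / norm v) *\<^sub>R v"
      using v_pos by (auto simp: diff_divide_distrib scaleR_diff_left)
    then have "dist v ((R / norm v) *\<^sub>R v) = norm v - R"
      using v v_pos by (simp add: dist_norm)
    ultimately show "dist v ((R / norm v) *\<^sub>R v) \<le> dist v z" by simp
  qed
qed (use R v in auto)

section \<open>Quadratic Lyapunov functions\<close>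

lemma definite_form_lower_bound:
  fixes M :: "real ^ 'n ^ 'n"
  assumes "\<And>v. v \<noteq> 0 \<Longrightarrow> v \<bullet> (M *v v) > 0"
  shows "\<exists>c>0. \<forall>v. c * (norm v)\<^sup>2 \<le> v \<bullet> (M *v v)"
proof -
  have cont: "continuous_on (sphere 0 1) (\<lambda>v. v \<bullet> (M *v v))"
    by (intro continuous_intros)
  have nonempty: "sphere (0 :: real ^ 'n) 1 \<noteq> {}" by simp
  obtain w where w: "w \<in> sphere 0 1"
    and min: "\<And>v. v \<in> sphere 0 1 \<Longrightarrow> w \<bullet> (M *v w) \<le> v \<bullet> (M *v v)"
    using continuous_attains_inf[OF compact_sphere nonempty cont] by blast
  have "w \<bullet> (M *v w) * (norm v)\<^sup>2 \<le> v \<bullet> (M *v v)" for v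
  proof (cases "v = 0")
    case False
    have "w \<bullet> (M *v w) \<le> sgn v \<bullet> (M *v sgn v)"
      using False by (intro min) (simp add: norm_sgn)
    also have "\<dots> = v \<bullet> (M *v v) / (norm v)\<^sup>2"
      by (simp add: sgn_div_norm matrix_vector_mult_scaleR power2_eq_square field_simps)
    finally show ?thesis using False by (simp add: field_simps)
  qed simp
  moreover have "w \<bullet> (M *v w) > 0" using w by (intro assms) auto
  ultimately show ?thesis by blast
qed

lemma matrix_form_upper_bound:
  fixes M :: "real ^ 'n ^ 'n"
  shows "\<exists>B>0. \<forall>v. v \<bullet> (M *v v) \<le> B * (norm v)\<^sup>2"
proof -
  obtain B where B: "B > 0" "\<And>v. norm (M *v v) \<le> norm v * B"
    using bounded_linear.pos_bounded[OF matrix_vector_mul_bounded_linear[of M]] by blast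
  have "v \<bullet> (M *v v) \<le> B * (norm v)\<^sup>2" for v
  proof -
    have "v \<bullet> (M *v v) \<le> norm v * norm (M *v v)" by (rule norm_cauchy_schwarz)
    also have "\<dots> \<le> norm v * (norm v * B)" using B by (intro mult_left_mono) auto
    finally show ?thesis by (simp add: power2_eq_square mult_ac)
  qed
  with B show ?thesis by blast
qed

text \<open>Scalar Gronwall inequality: \<open>W t * exp (c * t)\<close> has a nonpositive derivative.\<close>
lemma derivative_le_imp_exp_decay:
  fixes W :: "real \<Rightarrow> real"
  assumes deriv: "\<And>t. t \<ge> 0 \<Longrightarrow> (W has_vector_derivative W' t) (at t within {0..})"
    and le: "\<And>t. t \<ge> 0 \<Longrightarrow> W' t \<le> - c * W t" and t: "t \<ge> 0"
  shows "W t \<le> W 0 * exp (- c * t)"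
proof -
  let ?Z = "\<lambda>s. W s * exp (c * s)"
  have "(?Z has_derivative (\<lambda>h. h * ((W' s + c * W s) * exp (c * s)))) (at s within {0..t})"
    if "0 \<le> s" "s \<le> t" for s
  proof -
    have "(W has_real_derivative W' s) (at s within {0..t})"
      using deriv[OF that(1)] unfolding has_real_derivative_iff_has_vector_derivative
      by (rule has_vector_derivative_within_subset) auto
    then have "(?Z has_real_derivative (W' s + c * W s) * exp (c * s)) (at s within {0..t})"
      by (auto intro!: derivative_eq_intros simp: algebra_simps)
    then show ?thesis
      unfolding has_field_derivative_def by (rule has_derivative_eq_rhs) (auto simp: mult.commute)
  qed
  from mvt_very_simple[OF t this]
  obtain s where "s \<in> {0..t}" and s: "?Z t - ?Z 0 = (t - 0) * ((W' s + c * W s) * exp (c * s))"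
    by blast
  then have "?Z t - ?Z 0 \<le> 0"
    using le[of s] t \<open>s \<in> {0..t}\<close> by (simp add: mult_nonneg_nonpos mult_nonpos_nonneg)
  then show ?thesis by (simp add: exp_minus field_simps)
qed

lemma quadratic_form_along_solution:
  fixes e :: "real \<Rightarrow> real ^ 'n"
  assumes "ode_solution (\<lambda>t. f) {0..} e" and "t \<ge> 0"
  shows "((\<lambda>t. e t \<bullet> (P *v e t)) has_vector_derivative
           f (e t) \<bullet> (P *v e t) + e t \<bullet> (P *v f (e t))) (at t within {0..})"
proof -
  have e: "(e has_vector_derivative f (e t)) (at t within {0..})"
    using assms by (simp add: ode_solution_def)
  have "((\<lambda>t. P *v e t) has_vector_derivative P *v f (e t)) (at t within {0..})"
    by (rule bounded_linear.has_vector_derivative[OF matrix_vector_mul_bounded_linear e])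
  from bounded_bilinear.has_vector_derivative[OF bounded_bilinear_inner e this]
  show ?thesis by (simp add: add.commute)
qed

text \<open>
  Dissipation only confines a solution that is already known to exist.  The truncated field
  \<open>f \<circ> \<pi>\<close> has global solutions, and it inherits the dissipation inequality at every point, also
  outside the ball.  So no discussion of the first exit time is needed.
\<close>
lemma lyapunov_ode_solution_exists:
  fixes f :: "real ^ 'n \<Rightarrow> real ^ 'n"
  assumes lip: "\<And>R. R > 0 \<Longrightarrow> \<exists>L. L-lipschitz_on (cball 0 R) f"
    and pos: "\<And>v. v \<noteq> 0 \<Longrightarrow> v \<bullet> (P *v v) > 0"
    and dissip: "\<And>v. f v \<bullet> (P *v v) + v \<bullet> (P *v f v) \<le> 0"
  shows "\<exists>e. ode_solution (\<lambda>t. f) {0..} e \<and> e 0 = e0"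
proof -
  obtain c where c: "c > 0" "\<And>v. c * (norm v)\<^sup>2 \<le> v \<bullet> (P *v v)"
    using definite_form_lower_bound[OF pos] by blast
  \<comment> \<open>The sublevel set of the quadratic form through \<open>e0\<close> lies in the ball of radius
      \<open>sqrt (e0 \<bullet> (P *v e0) / c)\<close>; adding \<open>1\<close> makes the radius positive when \<open>e0 = 0\<close>.\<close>
  define R where "R = sqrt (e0 \<bullet> (P *v e0) / c) + 1"
  have quot_nonneg: "e0 \<bullet> (P *v e0) / c \<ge> 0"
    using c(1) c(2)[of e0] by (intro divide_nonneg_pos) (auto intro: order_trans[rotated])
  then have R: "R > 0" using real_sqrt_ge_zero[OF quot_nonneg] by (simp only: R_def)
  let ?\<pi> = "closest_point (cball 0 R) :: real ^ 'n \<Rightarrow> real ^ 'n"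
  have \<pi>_in: "?\<pi> v \<in> cball 0 R" for v
    using R by (intro closest_point_in_set) auto
  obtain L where L: "L-lipschitz_on (cball 0 R) f" using lip[OF R] by blast
  have "1-lipschitz_on UNIV ?\<pi>"
    using R by (intro lipschitz_onI) (auto intro: closest_point_lipschitz)
  moreover have "L-lipschitz_on (range ?\<pi>) f"
    using \<pi>_in by (intro lipschitz_on_subset[OF L]) auto
  ultimately have "(L * 1)-lipschitz_on UNIV (\<lambda>v. f (?\<pi> v))"
    by (rule lipschitz_on_compose2)
  from lipschitz_ode_solution_exists[OF this, of e0]
  obtain e where e: "ode_solution (\<lambda>t v. f (?\<pi> v)) {0..} e" and e_0: "e 0 = e0" by blast
  have dissip_trunc: "f (?\<pi> v) \<bullet> (P *v v) + v \<bullet> (P *v f (?\<pi> v)) \<le> 0" for v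
  proof (cases "norm v \<le> R")
    case True
    then show ?thesis using dissip[of v] by (simp add: closest_point_self)
  next
    case False
    let ?p = "?\<pi> v" and ?s = "norm v / R"
    have v: "v = ?s *\<^sub>R ?p" using R False by (simp add: closest_point_cball_0)
    have "f ?p \<bullet> (P *v v) + v \<bullet> (P *v f ?p) = ?s * (f ?p \<bullet> (P *v ?p) + ?p \<bullet> (P *v f ?p))"
      by (subst (2 3) v) (simp add: matrix_vector_mult_scaleR distrib_left)
    also have "\<dots> \<le> 0" using R dissip[of ?p] by (intro mult_nonneg_nonpos) auto
    finally show ?thesis .
  qed
  have "norm (e t) \<le> R" if "t \<ge> 0" for t
  proof -
    \<comment> \<open>The case of decay rate \<open>0\<close> says that the quadratic form does not increase.\<close>
    have "e t \<bullet> (P *v e t) \<le> e 0 \<bullet> (P *v e 0) * exp (- 0 * t)"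
      using quadratic_form_along_solution[OF e] dissip_trunc that
      by (intro derivative_le_imp_exp_decay) auto
    then have "(norm (e t))\<^sup>2 \<le> e0 \<bullet> (P *v e0) / c"
      using c(1) order_trans[OF c(2)[of "e t"]] by (simp add: e_0 field_simps)
    then have "norm (e t) \<le> sqrt (e0 \<bullet> (P *v e0) / c)" by (rule real_le_rsqrt)
    then show ?thesis by (simp add: R_def)
  qed
  then have "ode_solution (\<lambda>t. f) {0..} e"
    using e by (auto simp: ode_solution_def closest_point_self)
  with e_0 show ?thesis by blast
qed

theorem quadratic_lyapunov_globally_stable:
  fixes f :: "real ^ 'n \<Rightarrow> real ^ 'n"
  assumes lip: "\<And>R. R > 0 \<Longrightarrow> \<exists>L. L-lipschitz_on (cball 0 R) f"
    and pos: "\<And>v. v \<noteq> 0 \<Longrightarrow> v \<bullet> (P *v v) > 0"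
    and k: "k > 0"
    and decay: "\<And>v. f v \<bullet> (P *v v) + v \<bullet> (P *v f v) \<le> - k * (norm v)\<^sup>2"
  shows "globally_stable f"
proof -
  obtain a where a: "a > 0" "\<And>v. a * (norm v)\<^sup>2 \<le> v \<bullet> (P *v v)"
    using definite_form_lower_bound[OF pos] by blast
  obtain b where b: "b > 0" "\<And>v. v \<bullet> (P *v v) \<le> b * (norm v)\<^sup>2"
    using matrix_form_upper_bound[of P] by blast
  define G where "G = sqrt (b / a)"
  have G: "G > 0" using a b by (simp add: G_def)
  define r where "r = k / b"
  have r: "r > 0" using k b by (simp add: r_def)
  have envelope: "norm (e t) \<le> G * norm (e 0) * exp (- (r / 2) * t)"
    if e: "ode_solution (\<lambda>t. f) {0..} e" and t: "t \<ge> 0" for e t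
  proof (rule power2_le_imp_le)
    have "- k * (norm v)\<^sup>2 \<le> - r * (v \<bullet> (P *v v))" for v
      using b(1) k mult_left_mono[OF b(2)[of v], of r] r by (simp add: r_def)
    then have "f v \<bullet> (P *v v) + v \<bullet> (P *v f v) \<le> - r * (v \<bullet> (P *v v))" for v
      using decay order_trans by blast
    then have "e t \<bullet> (P *v e t) \<le> e 0 \<bullet> (P *v e 0) * exp (- r * t)"
      using quadratic_form_along_solution[OF e] t
      by (intro derivative_le_imp_exp_decay) auto
    also have "\<dots> \<le> b * (norm (e 0))\<^sup>2 * exp (- r * t)"
      using b by (intro mult_right_mono) auto
    finally have "a * (norm (e t))\<^sup>2 \<le> b * (norm (e 0))\<^sup>2 * exp (- r * t)"
      using a(2) order_trans by blast
    then have "(norm (e t))\<^sup>2 \<le> b / a * (norm (e 0))\<^sup>2 * exp (- r * t)"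
      using a(1) by (simp add: field_simps)
    also have "\<dots> = (G * norm (e 0) * exp (- (r / 2) * t))\<^sup>2"
      using a b by (simp add: G_def power_mult_distrib flip: exp_double)
    finally show "(norm (e t))\<^sup>2 \<le> (G * norm (e 0) * exp (- (r / 2) * t))\<^sup>2" .
  qed (use G in auto)
  have exists: "\<exists>e. ode_solution (\<lambda>t. f) {0..} e \<and> e 0 = e0" for e0
  proof (rule lyapunov_ode_solution_exists[OF lip pos])
    fix v :: "real ^ 'n"
    have "- k * (norm v)\<^sup>2 \<le> 0" using k by simp
    with decay[of v] show "f v \<bullet> (P *v v) + v \<bullet> (P *v f v) \<le> 0" by linarith
  qed auto
  have stable: "\<exists>\<delta>>0. \<forall>e. ode_solution (\<lambda>t. f) {0..} e \<and> norm (e 0) < \<delta> \<longrightarrow>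
      (\<forall>t\<ge>0. norm (e t) < \<epsilon>)" if \<epsilon>: "\<epsilon> > 0" for \<epsilon>
  proof (intro exI[of _ "\<epsilon> / G"] conjI allI impI)
    fix e and t :: real
    assume e: "ode_solution (\<lambda>t. f) {0..} e \<and> norm (e 0) < \<epsilon> / G" and t: "t \<ge> 0"
    have "norm (e t) \<le> G * norm (e 0) * exp (- (r / 2) * t)"
      using e t by (intro envelope) auto
    also have "\<dots> \<le> G * norm (e 0)"
      using G r t by (intro mult_left_le) auto
    also have "\<dots> < \<epsilon>" using e G by (simp add: field_simps)
    finally show "norm (e t) < \<epsilon>" .
  qed (use \<epsilon> G in auto)
  have attractive: "(e \<longlongrightarrow> 0) at_top" if e: "ode_solution (\<lambda>t. f) {0..} e" for e
  proof (rule Lim_null_comparison)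
    show "\<forall>\<^sub>F t in at_top. norm (e t) \<le> G * norm (e 0) * exp (- (r / 2) * t)"
      using eventually_ge_at_top[of 0] by eventually_elim (rule envelope[OF e])
    have "filterlim (\<lambda>t. - (r / 2) * t) at_bot at_top"
      using r by (intro filterlim_tendsto_neg_mult_at_bot[OF tendsto_const]) (auto simp: filterlim_ident)
    from tendsto_mult_left[OF filterlim_compose[OF exp_at_bot this], of "G * norm (e 0)"]
    show "((\<lambda>t. G * norm (e 0) * exp (- (r / 2) * t)) \<longlongrightarrow> 0) at_top" by simp
  qed
  show ?thesis
    unfolding globally_stable_def using exists stable attractive by blast
qed

section \<open>The cubic error dynamics\<close>

lemma lipschitz_on_bilinear:
  assumes bil: "bounded_bilinear pr" and S: "compact S"
    and f: "L-lipschitz_on S f" and g: "M-lipschitz_on S g"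
  shows "\<exists>K. K-lipschitz_on S (\<lambda>x. pr (f x) (g x))"
proof -
  interpret bounded_bilinear pr by (rule bil)
  obtain D where D: "D > 0" "\<And>x y. norm (pr x y) \<le> norm x * norm y * D"
    using pos_bounded by blast
  obtain F where F: "F > 0" "\<And>x. x \<in> S \<Longrightarrow> norm (f x) \<le> F"
    using compact_imp_bounded[OF compact_continuous_image[OF lipschitz_on_continuous_on[OF f] S]]
    by (auto simp: bounded_pos)
  obtain G where G: "G > 0" "\<And>x. x \<in> S \<Longrightarrow> norm (g x) \<le> G"
    using compact_imp_bounded[OF compact_continuous_image[OF lipschitz_on_continuous_on[OF g] S]]
    by (auto simp: bounded_pos)
  have L: "L \<ge> 0" and M: "M \<ge> 0" using f g by (auto intro: lipschitz_on_nonneg)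
  have "((L * G + F * M) * D)-lipschitz_on S (\<lambda>x. pr (f x) (g x))"
  proof (rule lipschitz_onI)
    fix x y assume xy: "x \<in> S" "y \<in> S"
    have "dist (pr (f x) (g x)) (pr (f y) (g y))
        = norm (pr (f x - f y) (g x) + pr (f y) (g x - g y))"
      by (simp add: dist_norm diff_left diff_right)
    also have "\<dots> \<le> norm (f x - f y) * norm (g x) * D + norm (f y) * norm (g x - g y) * D"
      by (intro norm_triangle_mono D)
    also have "\<dots> \<le> (L * dist x y) * G * D + F * (M * dist x y) * D"
      using xy D F G L M lipschitz_onD[OF f xy] lipschitz_onD[OF g xy]
      by (intro add_mono mult_right_mono mult_mono) (auto simp: dist_norm)
    finally show "dist (pr (f x) (g x)) (pr (f y) (g y)) \<le> (L * G + F * M) * D * dist x y"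
      by (simp add: algebra_simps)
  qed (use D F G L M in auto)
  then show ?thesis by blast
qed

lemma cubic_error_rhs_lipschitz_on_cball:
  "\<exists>K. K-lipschitz_on (cball 0 R) (cubic_error_rhs A C L N \<theta>)"
proof -
  have lin: "\<exists>K. K-lipschitz_on (cball 0 R) (\<lambda>v. M *v v)" for M :: "real ^ 'k ^ 'm"
    by (metis bounded_linear.lipschitz_boundE lipschitz_on_subset matrix_vector_mul_bounded_linear)
  obtain K1 where K1: "K1-lipschitz_on (cball 0 R) (\<lambda>v. (A - L ** C) *v v)" using lin by blast
  obtain K2 where K2: "K2-lipschitz_on (cball 0 R) (\<lambda>v. (transpose C ** \<theta> ** C) *v v)"
    using lin by blast
  obtain K3 where K3: "K3-lipschitz_on (cball 0 R) (\<lambda>v. (N ** C) *v v)" using lin by blast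
  obtain K4 where K4: "K4-lipschitz_on (cball 0 R) (\<lambda>v. v \<bullet> ((transpose C ** \<theta> ** C) *v v))"
    using lipschitz_on_bilinear[OF bounded_bilinear_inner compact_cball lipschitz_on_id K2] by blast
  obtain K5 where "K5-lipschitz_on (cball 0 R)
      (\<lambda>v. (v \<bullet> ((transpose C ** \<theta> ** C) *v v)) *\<^sub>R ((N ** C) *v v))"
    using lipschitz_on_bilinear[OF bounded_bilinear_scaleR compact_cball K4 K3] by blast
  from lipschitz_on_add[OF K1 this] show ?thesis
    by (auto simp: cubic_error_rhs_def[abs_def])
qed

lemma observer_error_solution:
  assumes x: "ode_solution (plant_rhs A B u) I x"
    and xh: "ode_solution (cubic_observer_rhs A B C L N \<theta> u x) I xh"
  shows "ode_solution (\<lambda>t. cubic_error_rhs A C L N \<theta>) I (\<lambda>t. x t - xh t)"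
  unfolding ode_solution_def
proof
  fix t assume "t \<in> I"
  then have "((\<lambda>t. x t - xh t) has_vector_derivative
      plant_rhs A B u t (x t) - cubic_observer_rhs A B C L N \<theta> u x t (xh t)) (at t within I)"
    using x xh by (intro has_vector_derivative_diff) (auto simp: ode_solution_def)
  moreover have "plant_rhs A B u t (x t) - cubic_observer_rhs A B C L N \<theta> u x t (xh t)
      = cubic_error_rhs A C L N \<theta> (x t - xh t)"
    by (simp add: plant_rhs_def cubic_observer_rhs_def cubic_error_rhs_def Let_def
        matrix_vector_mult_diff_rdistrib matrix_vector_mult_diff_distrib algebra_simps
        flip: matrix_vector_mul_assoc)
  ultimately show "((\<lambda>t. x t - xh t) has_vector_derivative
      cubic_error_rhs A C L N \<theta> (x t - xh t)) (at t within I)" by simp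
qed

text \<open>
  The left-hand side is the derivative of \<open>e \<bullet> (P *v e)\<close> along the error dynamics.  The weight
  \<open>e\<^sup>T C\<^sup>T \<theta> C e\<close> of the cubic term is a scalar, so it factors out of the second quadratic form; written
  as a form in \<open>C v\<close>, its sign follows from that of \<open>\<theta>\<close>.
\<close>
lemma lyapunov_derivative_decomposition:
  fixes A P :: "real ^ 'n ^ 'n" and C :: "real ^ 'n ^ 'y" and L N :: "real ^ 'y ^ 'n"
    and \<theta> :: "real ^ 'y ^ 'y"
  defines "f \<equiv> cubic_error_rhs A C L N \<theta>"
  shows "f v \<bullet> (P *v v) + v \<bullet> (P *v f v)
    = v \<bullet> ((transpose (A - L ** C) ** P + P ** (A - L ** C)) *v v)
      + ((C *v v) \<bullet> (\<theta> *v (C *v v)))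
        * (v \<bullet> ((P ** N ** C + transpose C ** transpose N ** P) *v v))"
proof -
  have adj: "x \<bullet> (transpose M *v z) = (M *v x) \<bullet> z"
    for M :: "real ^ 'k ^ 'm" and x z
    by (metis dot_lmul_matrix inner_commute transpose_matrix_vector)
  have F: "v \<bullet> ((transpose F ** P + P ** F) *v v) = (F *v v) \<bullet> (P *v v) + v \<bullet> (P *v (F *v v))"
    for F
    by (simp add: matrix_vector_mult_add_rdistrib inner_add_right adj
        del: transpose_matrix_vector flip: matrix_vector_mul_assoc)
  have G: "v \<bullet> ((P ** N ** C + transpose C ** transpose N ** P) *v v)
      = v \<bullet> (P *v ((N ** C) *v v)) + ((N ** C) *v v) \<bullet> (P *v v)"
    by (simp add: matrix_vector_mult_add_rdistrib inner_add_right adj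
        del: transpose_matrix_vector flip: matrix_vector_mul_assoc)
  have S: "v \<bullet> ((transpose C ** \<theta> ** C) *v v) = (C *v v) \<bullet> (\<theta> *v (C *v v))"
    by (simp add: adj del: transpose_matrix_vector flip: matrix_vector_mul_assoc)
  show ?thesis
    unfolding f_def cubic_error_rhs_def F G S
    by (simp add: inner_add_left matrix_vector_right_distrib inner_add_right
        matrix_vector_mult_scaleR distrib_left)
qed

theorem theorem1:
  fixes A :: "real ^ 'n ^ 'n"
    and B :: "real ^ 'u ^ 'n"
    and C :: "real ^ 'n ^ 'y"
    and L N :: "real ^ 'y ^ 'n"
    and \<theta> :: "real ^ 'y ^ 'y"
    and P :: "real ^ 'n ^ 'n"
  assumes "observable A C"
    and "pos_semidefinite \<theta>"
    and "pos_definite P"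
    and "\<not> (\<exists>v. v \<noteq> 0 \<and>
           (A - L ** C) *v v + (v \<bullet> ((transpose C ** \<theta> ** C) *v v)) *\<^sub>R ((N ** C) *v v) = 0)"
    and "neg_definite (transpose (A - L ** C) ** P + P ** (A - L ** C))"
    and "neg_definite (P ** N ** C + transpose C ** transpose N ** P)"
  shows "(\<forall>u x xh.
            ode_solution (plant_rhs A B u) {0..} x \<longrightarrow>
            ode_solution (cubic_observer_rhs A B C L N \<theta> u x) {0..} xh \<longrightarrow>
            ode_solution (\<lambda>t. cubic_error_rhs A C L N \<theta>) {0..} (\<lambda>t. x t - xh t)) \<and>
         globally_stable (cubic_error_rhs A C L N \<theta>)"
proof -
  let ?f = "cubic_error_rhs A C L N \<theta>"
  let ?Q = "transpose (A - L ** C) ** P + P ** (A - L ** C)"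
  let ?M = "P ** N ** C + transpose C ** transpose N ** P"
  have neg: "(- ?Q) *v v = - (?Q *v v)" for v
    using matrix_vector_mult_diff_rdistrib[of 0 ?Q v] by simp
  have "v \<bullet> ((- ?Q) *v v) > 0" if "v \<noteq> 0" for v
    using assms(5) that unfolding neg_definite_def neg by simp
  from definite_form_lower_bound[OF this]
  obtain k where k: "k > 0" "\<And>v. k * (norm v)\<^sup>2 \<le> v \<bullet> ((- ?Q) *v v)" by blast
  have "?f v \<bullet> (P *v v) + v \<bullet> (P *v ?f v) \<le> - k * (norm v)\<^sup>2" for v
  proof -
    have "v \<bullet> (?Q *v v) \<le> - k * (norm v)\<^sup>2"
      using k(2)[of v] unfolding neg by simp
    moreover have "v \<bullet> (?M *v v) \<le> 0"
      using assms(6) by (cases "v = 0") (auto simp: neg_definite_def intro: less_imp_le)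
    then have "((C *v v) \<bullet> (\<theta> *v (C *v v))) * (v \<bullet> (?M *v v)) \<le> 0"
      using assms(2) by (intro mult_nonneg_nonpos) (auto simp: pos_semidefinite_def)
    ultimately show ?thesis unfolding lyapunov_derivative_decomposition by linarith
  qed
  then have "globally_stable ?f"
    using assms(3) k(1) cubic_error_rhs_lipschitz_on_cball
    by (intro quadratic_lyapunov_globally_stable[of ?f P k]) (auto simp: pos_definite_def)
  then show ?thesis using observer_error_solution by blast
qed

end
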